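(* Let $\Omega=\Omega_1\times\dots\times\Omega_K$ with each $\Omega_k\subseteq\mathbb{R}^{n_k}$ a non-empty polyhedron, let $x^0\in\Omega$, and let $\{x^l\}$ be the sequence generated from $x^0$ by the trust region algorithm with alternating projections (TRAP) described in the context. Assume that (i) $L$ is bounded below on $\{x\in\Omega: L(x)\le L(x^0)\}$; (ii) $L$ is continuously differentiable in an open set containing $\Omega$ and its gradient $\nabla L$ is uniformly continuous; (iii) there exists $\hat B>0$ such that $\|B(x)\|_2\le\hat B$ for all $x\in\Omega$; (iv) $\{x^l\}$ has a non-degenerate limit point $x^{\ast}$ such that, for some $\kappa>0$, $\langle v,H(x^{\ast})v\rangle\ge\kappa\|v\|_2^2$ for all $v\in\mathcal{N}_\Omega(x^{\ast})^\perp:=\{v\in\mathbb{R}^n:\langle w,v\rangle=0\ \ \forall w\in\mathcal{N}_\Omega(x^{\ast})\}$, where $H=\nabla^2L$ denotes the Hessian of $L$. Then the sequence $\{x^l\}$ converges to a non-degenerate critical point $x^{\ast}$ of $L+\iota_\Omega$.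
   Context: Notation. $x=(x_1^\top,\dots,x_K^\top)^\top\in\mathbb{R}^n$ with $x_k\in\mathbb{R}^{n_k}$, $n=\sum_k n_k$. $\Omega_k=\{x_k\in\mathbb{R}^{n_k}:\langle\omega_{k,i},x_k\rangle\le h_{k,i},\ i=1,\dots,m_k\}$. $\iota_\Omega$ is the indicator function of $\Omega$. $P_S$ is the Euclidean projection onto the closed convex set $S$. $\mathcal{A}_{\Omega_k}(x_k)$ is the set of indices $i$ of constraints of $\Omega_k$ active at $x_k$. $\mathcal{N}_\Omega(x)=\{v:\langle v,y-x\rangle\le0\ \forall y\in\Omega\}$ and $\mathcal{T}_\Omega(x)$ are the normal and tangent cones to $\Omega$ at $x$. $g(x)=\nabla L(x)$. $x\in\Omega$ is a critical point of $L+\iota_\Omega$ iff $P_{\mathcal{T}_\Omega(x)}(-g(x))=0$, equivalently $-g(x)\in\mathcal{N}_\Omega(x)$; it is non-degenerate if $-g(x)\in\operatorname{ri}(\mathcal{N}_\Omega(x))$ (relative interior). Model. At an iterate $x\in\Omega$, with $B(x)\in\mathbb{R}^{n\times n}$ symmetric, $$m(x'):=L(x)+\langle g(x),x'-x\rangle+\tfrac12\langle x'-x,B(x)(x'-x)\rangle .$$ TRAP. Fixed parameters: initial radius $\Delta^0>0$; $0<\sigma_1<\sigma_2<1<\sigma_3$; $0<\eta_1<\eta_2<1$; $\gamma_1\in(0,1)$, $\gamma_2>0$; $\nu_0\in(0,1)$, $0<\nu_1<\nu_2$, $\nu_3,\nu_4,\nu_5>0$; $0<\underline\sigma<\bar\sigma$.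 One iteration from $x=x^l\in\Omega$ with radius $\Delta=\Delta^l>0$: (1) Cauchy point. For $k=1,\dots,K$ in order, let $m_k(u):=m(z_1,\dots,z_{k-1},u,x_{k+1},\dots,x_K)$ for $u\in\mathbb{R}^{n_k}$, $z_k(\alpha):=P_{\Omega_k}(x_k-\alpha\nabla m_k(x_k))$, and $z_k:=z_k(\alpha_k)$, where $\alpha_k>0$ satisfies: (a) $m_k(z_k)\le m_k(x_k)+\nu_0\langle\nabla m_k(x_k),z_k-x_k\rangle$ and $\|z_k-x_k\|_\infty\le\nu_2\Delta$; (b) $\alpha_k\in[\nu_4,\nu_5]$, or $\alpha_k\in[\nu_3\bar\alpha_k,\nu_5]$ for some $\bar\alpha_k>0$ such that $m_k(z_k(\bar\alpha_k))>m_k(x_k)+\nu_0\langle\nabla m_k(x_k),z_k(\bar\alpha_k)-x_k\rangle$ or $\|z_k(\bar\alpha_k)-x_k\|_\infty\ge\nu_1\Delta$. The Cauchy point is $z=z^l:=(z_1^\top,\dots,z_K^\top)^\top$. (2) Refinement. Find $y=y^l\in\Omega$ with $m(x)-m(y)\ge\gamma_1(m(x)-m(z))$, $\|y-x\|_\infty\le\gamma_2\Delta$, $\mathcal{A}_{\Omega_k}(z_k)\subseteq\mathcal{A}_{\Omega_k}(y_k)$ for all $k$. It is obtained by a monotone (safeguarded conjugate gradient) method started at $z$ on the regularised objective $m(y)+\frac{\sigma^l}{2}\|y-z\|_2^2$ with $\sigma^l\in(\underline\sigma,\bar\sigma)$, so that $m(y)+\frac{\sigma^l}{2}\|y-z\|_2^2\le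 m(z)$. (3) Update. $\rho^l:=\frac{L(x)-L(y)}{m(x)-m(y)}$. If $\rho^l<\eta_1$: $x^{l+1}=x^l$, $\Delta^{l+1}\in[\sigma_1\Delta^l,\sigma_2\Delta^l]$. If $\rho^l\in[\eta_1,\eta_2]$: $x^{l+1}=y^l$, $\Delta^{l+1}\in[\sigma_1\Delta^l,\sigma_3\Delta^l]$. If $\rho^l>\eta_2$: $x^{l+1}=y^l$, $\Delta^{l+1}\in[\Delta^l,\sigma_3\Delta^l]$. The stopping tolerance is taken to be $0$ and no iterate is critical, so that infinite sequences are generated. *)

theory Defs
  imports "HOL-Analysis.Analysis"
begin

section \<open>First- and second-order notions\<close>

definition gradient :: "('a::real_inner \<Rightarrow> real) \<Rightarrow> 'a \<Rightarrow> 'a" where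
  "gradient f x = (THE D. GDERIV f x :> D)"

definition hessian :: "(real^'n \<Rightarrow> real) \<Rightarrow> real^'n \<Rightarrow> real^'n^'n" where
  "hessian f x = jacobian (gradient f) (at x)"

definition normal_cone :: "'a::real_inner set \<Rightarrow> 'a \<Rightarrow> 'a set" where
  "normal_cone S x = {v. \<forall>y\<in>S. v \<bullet> (y - x) \<le> 0}"

text \<open>The closure of the cone of feasible directions; this is the tangent cone for convex \<open>S\<close>,
  the only case in which it is used.\<close>

definition tangent_cone :: "'a::real_inner set \<Rightarrow> 'a \<Rightarrow> 'a set" where
  "tangent_cone S x = closure (conic hull ((\<lambda>y. y - x) ` S))"

definition critical_point :: "('a::euclidean_space \<Rightarrow> real) \<Rightarrow> 'a set \<Rightarrow> 'a \<Rightarrow> bool" where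
  "critical_point f S x \<longleftrightarrow>
     x \<in> S \<and> closest_point (tangent_cone S x) (- gradient f x) = 0"

definition nondegenerate :: "('a::euclidean_space \<Rightarrow> real) \<Rightarrow> 'a set \<Rightarrow> 'a \<Rightarrow> bool" where
  "nondegenerate f S x \<longleftrightarrow> - gradient f x \<in> rel_interior (normal_cone S x)"

section \<open>Block-structured polyhedra\<close>

text \<open>
  The decomposition of the ambient space into \<open>K\<close> blocks is given by the map \<open>blk\<close>, which sends each coordinate to the number of its block; the dimension of block \<open>k\<close> is the
  number of coordinates that \<open>blk\<close> sends to \<open>k\<close> (a finite index type
  carries no order, so that stacking the blocks is only a matter of indexing). A vector of the \<open>k\<close>-th factor is represented by
  the ambient vector that has its entries in block \<open>k\<close> and zeros elsewhere. Inner product,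
  Euclidean norm, maximum norm, gradient and projection of the factor are then those of the
  ambient space.
\<close>

record ('n::finite) block_polyhedron =
  K :: nat
  blk :: "'n \<Rightarrow> nat"
  ncons :: "nat \<Rightarrow> nat"
  \<omega> :: "nat \<Rightarrow> nat \<Rightarrow> real^'n"
  h :: "nat \<Rightarrow> nat \<Rightarrow> real"

definition block_space :: "'n::finite block_polyhedron \<Rightarrow> nat \<Rightarrow> (real^'n) set" where
  "block_space Q k = {v. \<forall>i. blk Q i \<noteq> k \<longrightarrow> v $ i = 0}"

definition block :: "'n::finite block_polyhedron \<Rightarrow> nat \<Rightarrow> real^'n \<Rightarrow> real^'n" where
  "block Q k x = (\<chi> i. if blk Q i = k then x $ i else 0)"

definition well_typed :: "'n::finite block_polyhedron \<Rightarrow> bool" where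
  "well_typed Q \<longleftrightarrow>
     (\<forall>i. blk Q i \<in> {1..K Q}) \<and>
     (\<forall>k\<in>{1..K Q}. \<forall>i\<in>{1..ncons Q k}. \<omega> Q k i \<in> block_space Q k)"

definition \<Omega>_block :: "'n::finite block_polyhedron \<Rightarrow> nat \<Rightarrow> (real^'n) set" where
  "\<Omega>_block Q k = {u \<in> block_space Q k. \<forall>i\<in>{1..ncons Q k}. \<omega> Q k i \<bullet> u \<le> h Q k i}"

definition \<Omega> :: "'n::finite block_polyhedron \<Rightarrow> (real^'n) set" where
  "\<Omega> Q = {x. \<forall>k\<in>{1..K Q}. block Q k x \<in> \<Omega>_block Q k}"

definition active_set :: "'n::finite block_polyhedron \<Rightarrow> nat \<Rightarrow> real^'n \<Rightarrow> nat set" where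
  "active_set Q k u = {i \<in> {1..ncons Q k}. \<omega> Q k i \<bullet> u = h Q k i}"

text \<open>\<open>splice Q k z u x\<close> is the vector with blocks
  \<open>z\<^sub>1, \<dots>, z\<^sub>k\<^sub>-\<^sub>1, u\<^sub>k, x\<^sub>k\<^sub>+\<^sub>1, \<dots>, x\<^sub>K\<close>.\<close>

definition splice ::
    "'n::finite block_polyhedron \<Rightarrow> nat \<Rightarrow> real^'n \<Rightarrow> real^'n \<Rightarrow> real^'n \<Rightarrow> real^'n" where
  "splice Q k z u x =
     (\<chi> i. if blk Q i < k then z $ i else if blk Q i = k then u $ i else x $ i)"

section \<open>The trust region algorithm with alternating projections\<close>

record trap_params =
  \<Delta>\<^sub>0 :: real
  \<sigma>\<^sub>1 :: real
  \<sigma>\<^sub>2 :: real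
  \<sigma>\<^sub>3 :: real
  \<eta>\<^sub>1 :: real
  \<eta>\<^sub>2 :: real
  \<gamma>\<^sub>1 :: real
  \<gamma>\<^sub>2 :: real
  \<nu>\<^sub>0 :: real
  \<nu>\<^sub>1 :: real
  \<nu>\<^sub>2 :: real
  \<nu>\<^sub>3 :: real
  \<nu>\<^sub>4 :: real
  \<nu>\<^sub>5 :: real
  \<sigma>_lower :: real
  \<sigma>_upper :: real

definition admissible :: "trap_params \<Rightarrow> bool" where
  "admissible p \<longleftrightarrow>
     0 < \<Delta>\<^sub>0 p \<and>
     0 < \<sigma>\<^sub>1 p \<and> \<sigma>\<^sub>1 p < \<sigma>\<^sub>2 p \<and> \<sigma>\<^sub>2 p < 1 \<and> 1 < \<sigma>\<^sub>3 p \<and>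
     0 < \<eta>\<^sub>1 p \<and> \<eta>\<^sub>1 p < \<eta>\<^sub>2 p \<and> \<eta>\<^sub>2 p < 1 \<and>
     0 < \<gamma>\<^sub>1 p \<and> \<gamma>\<^sub>1 p < 1 \<and> 0 < \<gamma>\<^sub>2 p \<and>
     0 < \<nu>\<^sub>0 p \<and> \<nu>\<^sub>0 p < 1 \<and> 0 < \<nu>\<^sub>1 p \<and> \<nu>\<^sub>1 p < \<nu>\<^sub>2 p \<and>
     0 < \<nu>\<^sub>3 p \<and> 0 < \<nu>\<^sub>4 p \<and> 0 < \<nu>\<^sub>5 p \<and>
     0 < \<sigma>_lower p \<and> \<sigma>_lower p < \<sigma>_upper p"

definition model :: "(real^'n \<Rightarrow> real) \<Rightarrow> (real^'n \<Rightarrow> real^'n^'n) \<Rightarrow> real^'n \<Rightarrow> real^'n \<Rightarrow> real" where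
  "model L B x x' =
     L x + gradient L x \<bullet> (x' - x) + 1/2 * ((x' - x) \<bullet> (B x *v (x' - x)))"

text \<open>As a function on the ambient space, \<open>mk\<close> below only depends on block \<open>k\<close> of its argument, so
  its gradient lies in \<open>block_space Q k\<close> and is the gradient with respect to that block.\<close>

definition cauchy_point ::
    "trap_params \<Rightarrow> 'n::finite block_polyhedron \<Rightarrow> (real^'n \<Rightarrow> real) \<Rightarrow> (real^'n \<Rightarrow> real^'n^'n) \<Rightarrow>
     real^'n \<Rightarrow> real \<Rightarrow> real^'n \<Rightarrow> bool" where
  "cauchy_point p Q L B x \<Delta> z \<longleftrightarrow>
     (\<forall>k\<in>{1..K Q}.
        let mk = (\<lambda>u. model L B x (splice Q k z u x));
            xk = block Q k x;
            gk = gradient mk xk;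
            zk = (\<lambda>\<alpha>. closest_point (\<Omega>_block Q k) (xk - \<alpha> *\<^sub>R gk))
        in \<exists>\<alpha>>0.
             block Q k z = zk \<alpha> \<and>
             mk (zk \<alpha>) \<le> mk xk + \<nu>\<^sub>0 p * (gk \<bullet> (zk \<alpha> - xk)) \<and>
             infnorm (zk \<alpha> - xk) \<le> \<nu>\<^sub>2 p * \<Delta> \<and>
             (\<alpha> \<in> {\<nu>\<^sub>4 p..\<nu>\<^sub>5 p} \<or>
              (\<exists>\<beta>>0. \<alpha> \<in> {\<nu>\<^sub>3 p * \<beta>..\<nu>\<^sub>5 p} \<and>
                 (mk (zk \<beta>) > mk xk + \<nu>\<^sub>0 p * (gk \<bullet> (zk \<beta> - xk)) \<or>
                  infnorm (zk \<beta> - xk) \<ge> \<nu>\<^sub>1 p * \<Delta>))))"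

text \<open>The refinement is characterised by the properties guaranteed by the inner solver: the last
  conjunct is the monotonicity of that solver, which starts at \<open>z\<close>.\<close>

definition refinement ::
    "trap_params \<Rightarrow> 'n::finite block_polyhedron \<Rightarrow> (real^'n \<Rightarrow> real) \<Rightarrow> (real^'n \<Rightarrow> real^'n^'n) \<Rightarrow>
     real^'n \<Rightarrow> real \<Rightarrow> real^'n \<Rightarrow> real^'n \<Rightarrow> bool" where
  "refinement p Q L B x \<Delta> z y \<longleftrightarrow>
     (let m = model L B x
      in y \<in> \<Omega> Q \<and>
         m x - m y \<ge> \<gamma>\<^sub>1 p * (m x - m z) \<and>
         infnorm (y - x) \<le> \<gamma>\<^sub>2 p * \<Delta> \<and>
         (\<forall>k\<in>{1..K Q}. active_set Q k (block Q k z) \<subseteq> active_set Q k (block Q k y)) \<and>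
         (\<exists>\<sigma>\<in>{\<sigma>_lower p<..<\<sigma>_upper p}. m y + \<sigma> / 2 * (norm (y - z))\<^sup>2 \<le> m z))"

definition update ::
    "trap_params \<Rightarrow> (real^'n \<Rightarrow> real) \<Rightarrow> (real^'n \<Rightarrow> real^'n^'n) \<Rightarrow>
     real^'n \<Rightarrow> real \<Rightarrow> real^'n \<Rightarrow> real^'n \<Rightarrow> real \<Rightarrow> bool" where
  "update p L B x \<Delta> y x' \<Delta>' \<longleftrightarrow>
     (let \<rho> = (L x - L y) / (model L B x x - model L B x y)
      in (\<rho> < \<eta>\<^sub>1 p \<longrightarrow> x' = x \<and> \<Delta>' \<in> {\<sigma>\<^sub>1 p * \<Delta>..\<sigma>\<^sub>2 p * \<Delta>}) \<and>
         (\<rho> \<in> {\<eta>\<^sub>1 p..\<eta>\<^sub>2 p} \<longrightarrow> x' = y \<and> \<Delta>' \<in> {\<sigma>\<^sub>1 p * \<Delta>..\<sigma>\<^sub>3 p * \<Delta>}) \<and>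
         (\<rho> > \<eta>\<^sub>2 p \<longrightarrow> x' = y \<and> \<Delta>' \<in> {\<Delta>..\<sigma>\<^sub>3 p * \<Delta>}))"

definition trap_sequence ::
    "trap_params \<Rightarrow> 'n::finite block_polyhedron \<Rightarrow> (real^'n \<Rightarrow> real) \<Rightarrow> (real^'n \<Rightarrow> real^'n^'n) \<Rightarrow>
     real^'n \<Rightarrow> (nat \<Rightarrow> real^'n) \<Rightarrow> (nat \<Rightarrow> real) \<Rightarrow> bool" where
  "trap_sequence p Q L B x0 X \<Delta> \<longleftrightarrow>
     X 0 = x0 \<and> \<Delta> 0 = \<Delta>\<^sub>0 p \<and>
     (\<forall>l. \<exists>z y. cauchy_point p Q L B (X l) (\<Delta> l) z \<and>
                refinement p Q L B (X l) (\<Delta> l) z y \<and>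
                update p L B (X l) (\<Delta> l) y (X (Suc l)) (\<Delta> (Suc l)))"

end

theory Submission
  imports Defs
begin

text \<open>Non-degeneracy makes \<open>xs\<close> critical, and a feasible direction along which \<open>L\<close> is stationary to
  first order is then orthogonal to the whole normal cone; so positivity of the Hessian there makes
  \<open>xs\<close> a strict local minimiser of \<open>L\<close> on \<open>\<Omega>\<close>. Near \<open>xs\<close> the steps are short: the Cauchy point
  \<open>z\<close> is close to the iterate \<open>x\<close>, because \<open>xs\<close> is fixed by every projected gradient step and
  projections are nonexpansive; and if \<open>y\<close> is accepted, then
  \<open>\<sigma>/2 \<parallel>y - z\<parallel>\<^sup>2 \<le> m z - m y \<le> m x - m y \<le> (L x - L y) / \<eta>\<^sub>1\<close>, which tends to \<open>0\<close> since \<open>L\<close> is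
  decreasing and bounded below along the iterates. Hence iterates that are close to \<open>xs\<close> stay there.\<close>

section \<open>Gradients and second-order expansion\<close>

lemma gradient_eqI:
  fixes f :: "'a::real_inner \<Rightarrow> real"
  assumes "GDERIV f x :> D"
  shows "gradient f x = D"
  unfolding gradient_def
proof (rule the_equality)
  fix D' assume "GDERIV f x :> D'"
  then have "(\<lambda>h. h \<bullet> D') = (\<lambda>h. h \<bullet> D)"
    using assms unfolding gderiv_def by (rule has_derivative_unique)
  then have "(D' - D) \<bullet> (D' - D) = 0"
    by (metis cancel_comm_monoid_add_class.diff_cancel inner_diff_right)
  then show "D' = D" by simp
qed (use assms in simp)

text \<open>Riesz representation: the derivative is a linear functional, and
  \<open>adjoint f' 1\<close> represents it.\<close>

lemma gderiv_gradient:
  fixes f :: "'a::euclidean_space \<Rightarrow> real"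
  assumes "f differentiable (at x)"
  shows "GDERIV f x :> gradient f x"
proof -
  obtain f' where f': "(f has_derivative f') (at x)"
    using assms by (auto simp: differentiable_def)
  then have lin: "linear f'"
    using has_derivative_linear by blast
  have "f' h = h \<bullet> adjoint f' 1" for h
    using adjoint_works[OF lin, of h 1] by simp
  then have "f' = (\<lambda>h. h \<bullet> adjoint f' 1)" by (rule ext)
  then have "GDERIV f x :> adjoint f' 1"
    using f' unfolding gderiv_def by metis
  then show ?thesis using gradient_eqI by metis
qed

text \<open>Second derivatives may exist at \<open>a\<close> only. The mean value theorem, used once
  along the segment, turns the quadratic remainder of \<open>f\<close> into the first-order
  remainder of \<open>gradient f\<close> at \<open>a\<close>, paired with \<open>d\<close>.\<close>

lemma second_order_expansion:
  fixes f :: "'a::euclidean_space \<Rightarrow> real"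
  assumes U: "open U" "a \<in> U" "\<And>x. x \<in> U \<Longrightarrow> f differentiable (at x)"
    and H: "(gradient f has_derivative H) (at a)"
    and "e > 0"
  obtains \<delta> where "\<delta> > 0"
    "\<And>d. norm d < \<delta> \<Longrightarrow> \<bar>f (a + d) - f a - gradient f a \<bullet> d - 1/2 * (d \<bullet> H d)\<bar> \<le> e * (norm d)\<^sup>2"
proof -
  have lin: "linear H" using H has_derivative_linear by blast
  obtain \<delta>1 where \<delta>1: "\<delta>1 > 0" "ball a \<delta>1 \<subseteq> U"
    using U open_contains_ball by meson
  obtain \<delta>2 where \<delta>2: "\<delta>2 > 0" "\<And>y. norm (y - a) < \<delta>2 \<Longrightarrow>
      norm (gradient f y - gradient f a - H (y - a)) \<le> e * norm (y - a)"
    using H \<open>e > 0\<close> unfolding has_derivative_at_alt by meson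
  have "\<bar>f (a + d) - f a - gradient f a \<bullet> d - 1/2 * (d \<bullet> H d)\<bar> \<le> e * (norm d)\<^sup>2"
    if d: "norm d < min \<delta>1 \<delta>2" for d
  proof -
    \<comment> \<open>The expansion is subtracted along the segment, so
      \<open>\<phi> 1 - \<phi> 0\<close> is the remainder to be bounded.\<close>
    define \<phi> where "\<phi> t = f (a + t *\<^sub>R d) - t * (gradient f a \<bullet> d) - t\<^sup>2 / 2 * (d \<bullet> H d)" for t
    define \<phi>' where "\<phi>' t = (gradient f (a + t *\<^sub>R d) - gradient f a - H (t *\<^sub>R d)) \<bullet> d" for t
    have small: "norm (t *\<^sub>R d) < min \<delta>1 \<delta>2" if "0 \<le> t" "t \<le> 1" for t
      using that d mult_left_le_one_le[of "norm d" t] by auto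
    have der: "(\<phi> has_derivative (\<lambda>h. h * \<phi>' t)) (at t within {0..1})" if t: "0 \<le> t" "t \<le> 1" for t
    proof -
      have "a + t *\<^sub>R d \<in> U"
        using small[OF t] \<delta>1(2) by (auto simp: dist_norm)
      then have "(f has_derivative (\<lambda>h. h \<bullet> gradient f (a + t *\<^sub>R d))) (at (a + t *\<^sub>R d))"
        using gderiv_gradient U(3) unfolding gderiv_def by blast
      then have "((\<lambda>t. f (a + t *\<^sub>R d)) has_derivative (\<lambda>h. (h *\<^sub>R d) \<bullet> gradient f (a + t *\<^sub>R d)))
          (at t within {0..1})"
        by (rule has_derivative_compose[rotated]) (auto intro!: derivative_eq_intros)
      then show ?thesis unfolding \<phi>_def \<phi>'_def
        by (auto intro!: derivative_eq_intros
            simp: linear_scale[OF lin] inner_diff_left algebra_simps inner_commute fun_eq_iff)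
    qed
    obtain t where t: "t \<in> {0..1}" "\<phi> 1 - \<phi> 0 = \<phi>' t"
      using mvt_very_simple[of 0 1 \<phi> "\<lambda>t h. h * \<phi>' t"] der by auto
    have "\<bar>\<phi>' t\<bar> \<le> norm (gradient f (a + t *\<^sub>R d) - gradient f a - H (t *\<^sub>R d)) * norm d"
      unfolding \<phi>'_def by (rule Cauchy_Schwarz_ineq2)
    also have "\<dots> \<le> (e * norm (t *\<^sub>R d)) * norm d"
      using \<delta>2(2)[of "a + t *\<^sub>R d"] small[of t] t by (intro mult_right_mono) auto
    also have "\<dots> \<le> e * (norm d)\<^sup>2"
      using t \<open>e > 0\<close> by (auto simp: power2_eq_square mult_left_le_one_le mult.assoc)
    finally show ?thesis
      using t(2) by (simp add: \<phi>_def)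
  qed
  then show thesis
    using that[of "min \<delta>1 \<delta>2"] \<delta>1(1) \<delta>2(1) by auto
qed

section \<open>Normal cones, projections and criticality\<close>

lemma normal_cone_tangent_cone:
  assumes w: "w \<in> normal_cone S x" and t: "t \<in> tangent_cone S x"
  shows "w \<bullet> t \<le> 0"
proof -
  have "conic hull ((\<lambda>y. y - x) ` S) \<subseteq> {t. w \<bullet> t \<le> 0}"
    using w by (auto simp: conic_hull_explicit normal_cone_def mult_nonneg_nonpos)
  then have "tangent_cone S x \<subseteq> {t. w \<bullet> t \<le> 0}"
    unfolding tangent_cone_def by (rule closure_minimal) (rule closed_halfspace_le)
  then show ?thesis using t by blast
qed

lemma closest_point_eqI:
  fixes a :: "'a::euclidean_space"
  assumes "convex S" "closed S" "x \<in> S" "\<And>y. y \<in> S \<Longrightarrow> (a - x) \<bullet> (y - x) \<le> 0"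
  shows "closest_point S a = x"
proof -
  have "dist a x \<le> dist a y" if "y \<in> S" for y
  proof -
    have "(norm (a - y))\<^sup>2 = (norm (a - x))\<^sup>2 - 2 * ((a - x) \<bullet> (y - x)) + (norm (y - x))\<^sup>2"
      by (simp add: power2_norm_eq_inner algebra_simps inner_commute)
    with assms(4)[OF that] have "(norm (a - x))\<^sup>2 \<le> (norm (a - y))\<^sup>2"
      by (smt (verit) zero_le_power2)
    then show ?thesis by (simp add: dist_norm)
  qed
  then show ?thesis using closest_point_unique[OF assms(1-3)] by metis
qed

text \<open>Normal vectors make no acute angle with tangent directions, so \<open>0\<close> meets
  the variational inequality for the projection of \<open>- gradient f x\<close> onto the tangent
  cone.\<close>

lemma critical_pointI:
  assumes "convex S" "x \<in> S" "- gradient f x \<in> normal_cone S x"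
  shows "critical_point f S x"
proof -
  have "closest_point (tangent_cone S x) (- gradient f x) = 0"
  proof (rule closest_point_eqI)
    have "convex ((\<lambda>y. y - x) ` S)"
      using assms(1) by (simp add: convex_translation_subtract_eq)
    then show "convex (tangent_cone S x)"
      unfolding tangent_cone_def by (intro convex_closure convex_conic_hull)
    show "0 \<in> tangent_cone S x"
      unfolding tangent_cone_def
      by (rule subsetD[OF closure_subset], subst conic_hull_contains_0) (use assms in auto)
  qed (use normal_cone_tangent_cone[OF assms(3)] in \<open>auto simp: tangent_cone_def\<close>)
  then show ?thesis using assms by (simp add: critical_point_def)
qed

section \<open>Non-degeneracy and second-order sufficiency\<close>

text \<open>From \<open>w\<close>, the segment to \<open>g\<close> can be prolonged slightly beyond
  \<open>g\<close> inside the cone, because \<open>g\<close> is in the relative interior; as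
  \<open>d\<close> pairs nonnegatively with \<open>g\<close>, its pairing with \<open>w\<close>
  cannot be negative.\<close>

lemma rel_interior_normal_cone_orthogonal:
  fixes S :: "'a::euclidean_space set"
  assumes g: "g \<in> rel_interior (normal_cone S x)"
    and d: "\<And>w. w \<in> normal_cone S x \<Longrightarrow> w \<bullet> d \<le> 0"
    and gd: "g \<bullet> d \<ge> 0"
  shows "d \<in> (normal_cone S x)\<^sup>\<bottom>"
proof -
  have "convex (normal_cone S x)"
    unfolding normal_cone_def
    by (auto simp: convex_def inner_add_left intro!: add_nonpos_nonpos mult_nonneg_nonpos)
  have "w \<bullet> d = 0" if w: "w \<in> normal_cone S x" for w
  proof -
    obtain e where e: "e > 1" "(1 - e) *\<^sub>R w + e *\<^sub>R g \<in> normal_cone S x"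
      using convex_rel_interior_if2[OF \<open>convex _\<close> g] w hull_inc by meson
    then have "(1 - e) * (w \<bullet> d) + e * (g \<bullet> d) \<le> 0"
      using d[OF e(2)] by (simp add: inner_add_left)
    then have "(1 - e) * (w \<bullet> d) \<le> 0"
      using gd e(1) by (smt (verit) mult_nonneg_nonneg)
    then have "w \<bullet> d \<ge> 0"
      using e(1) by (simp add: mult_le_0_iff)
    then show ?thesis using d[OF w] by simp
  qed
  then show ?thesis by (simp add: orthogonal_comp_def orthogonal_def)
qed

text \<open>If points of \<open>S\<close> tending to \<open>a\<close> had values at most
  \<open>f a\<close>, their normalised directions would accumulate at a unit vector
  \<open>d\<close>. First-order terms put \<open>d\<close> in the orthogonal complement of the
  normal cone; second-order terms then contradict \<open>pos\<close>.\<close>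

lemma nondegenerate_strict_local_minimum:
  fixes f :: "'a::euclidean_space \<Rightarrow> real"
  assumes U: "open U" "a \<in> U" "\<And>x. x \<in> U \<Longrightarrow> f differentiable (at x)"
    and H: "(gradient f has_derivative H) (at a)"
    and nd: "nondegenerate f S a"
    and "\<kappa> > 0"
    and pos: "\<And>v. v \<in> (normal_cone S a)\<^sup>\<bottom> \<Longrightarrow> v \<bullet> H v \<ge> \<kappa> * (norm v)\<^sup>2"
  obtains r where "r > 0" "\<And>x. \<lbrakk>x \<in> S; x \<noteq> a; dist x a \<le> r\<rbrakk> \<Longrightarrow> f a < f x"
proof -
  have g: "- gradient f a \<in> rel_interior (normal_cone S a)"
    using nd by (simp add: nondegenerate_def)
  then have gN: "- gradient f a \<in> normal_cone S a"
    using rel_interior_subset by blast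
  have "\<exists>r>0. \<forall>x. x \<in> S \<longrightarrow> x \<noteq> a \<longrightarrow> dist x a \<le> r \<longrightarrow> f a < f x"
  proof (rule ccontr)
    assume "\<not> ?thesis"
    then have "\<exists>x. x \<in> S \<and> x \<noteq> a \<and> dist x a \<le> inverse (Suc n) \<and> f x \<le> f a" for n
      by (meson inverse_positive_iff_positive not_le of_nat_0_less_iff zero_less_Suc)
    then obtain x where x: "\<And>n. x n \<in> S" "\<And>n. x n \<noteq> a"
        "\<And>n. dist (x n) a \<le> inverse (Suc n)" "\<And>n. f (x n) \<le> f a"
      by metis
    define t where "t n = norm (x n - a)" for n
    define u where "u n = (x n - a) /\<^sub>R t n" for n
    have tpos: "t n > 0" for n using x(2) by (simp add: t_def)
    have t0: "t \<longlonglongrightarrow> 0"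
      by (rule Lim_null_comparison[OF _ LIMSEQ_inverse_real_of_nat])
         (use x(3) in \<open>simp add: t_def dist_norm\<close>)
    have tu: "x n = a + t n *\<^sub>R u n" for n
      using tpos[of n] by (simp add: u_def)
    have nu: "norm (u n) = 1" for n
      using tpos[of n] by (simp add: u_def) (simp add: t_def)
    obtain d s where d: "d \<in> sphere 0 1" "strict_mono s" "(u \<circ> s) \<longlonglongrightarrow> d"
      using compact_sphere[of 0 1] nu unfolding compact_def by (metis mem_sphere_0)
    have ts0: "(\<lambda>n. t (s n)) \<longlonglongrightarrow> 0"
      using LIMSEQ_subseq_LIMSEQ[OF t0 d(2)] by (simp add: o_def)
    have us: "(\<lambda>n. u (s n)) \<longlonglongrightarrow> d"
      using d(3) by (simp add: o_def)
    have lim: "(\<lambda>n. u (s n) \<bullet> H (u (s n))) \<longlonglongrightarrow> d \<bullet> H d"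
      by (rule tendsto_inner[OF us bounded_linear.tendsto[OF has_derivative_bounded_linear[OF H] us]])
    have Nu: "w \<bullet> u n \<le> 0" if "w \<in> normal_cone S a" for w n
      using that x(1)[of n] tpos[of n] unfolding normal_cone_def u_def
      by (simp add: mult_nonneg_nonpos)
    have Nd: "w \<bullet> d \<le> 0" if "w \<in> normal_cone S a" for w
      using Nu[OF that] by (intro LIMSEQ_le_const2[OF tendsto_inner[OF tendsto_const us]]) auto
    have gu: "gradient f a \<bullet> u n \<ge> 0" for n
      using Nu[OF gN, of n] by simp
    \<comment> \<open>The expansion at \<open>a\<close> combined with
      \<open>f (x n) \<le> f a\<close>, divided by the distance \<open>t\<close>.\<close>
    have ev: "eventually (\<lambda>n. gradient f a \<bullet> u (s n) + t (s n) / 2 * (u (s n) \<bullet> H (u (s n)))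
                \<le> e * t (s n)) sequentially" if "e > 0" for e
    proof -
      obtain \<delta> where \<delta>: "\<delta> > 0" "\<And>d. norm d < \<delta> \<Longrightarrow>
          \<bar>f (a + d) - f a - gradient f a \<bullet> d - 1/2 * (d \<bullet> H d)\<bar> \<le> e * (norm d)\<^sup>2"
        using second_order_expansion[OF U H \<open>e > 0\<close>] by blast
      have "eventually (\<lambda>n. t (s n) < \<delta>) sequentially"
        using order_tendstoD(2)[OF ts0 \<delta>(1)] .
      then show ?thesis
      proof eventually_elim
        case (elim n)
        let ?t = "t (s n)" and ?u = "u (s n)"
        have "\<bar>f (x (s n)) - f a - ?t * (gradient f a \<bullet> ?u) - 1/2 * (?t * (?t * (?u \<bullet> H ?u)))\<bar>
            \<le> e * ?t\<^sup>2"
          using \<delta>(2)[of "?t *\<^sub>R ?u"] elim tpos[of "s n"]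
          by (simp add: nu linear_scale[OF has_derivative_linear[OF H]] flip: tu)
        with x(4)[of "s n"]
        have "?t * (gradient f a \<bullet> ?u + ?t / 2 * (?u \<bullet> H ?u)) \<le> ?t * (e * ?t)"
          by (simp add: algebra_simps power2_eq_square)
        then show ?case using tpos by (simp add: mult_le_cancel_left)
      qed
    qed
    \<comment> \<open>The limit of \<open>ev\<close>: as \<open>t\<close> tends to \<open>0\<close>,
      only the gradient term survives, whatever \<open>e\<close> is.\<close>
    have "gradient f a \<bullet> d \<le> 0"
    proof (rule tendsto_le[OF sequentially_bot])
      show "(\<lambda>n. 1 * t (s n)) \<longlonglongrightarrow> 0" using ts0 by simp
      show "(\<lambda>n. gradient f a \<bullet> u (s n) + t (s n) / 2 * (u (s n) \<bullet> H (u (s n))))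
          \<longlonglongrightarrow> gradient f a \<bullet> d"
        using tendsto_add[OF tendsto_inner[OF tendsto_const us]
            tendsto_mult[OF tendsto_divide[OF ts0 tendsto_const[of 2]] lim]] by simp
    qed (rule ev[of 1], simp)
    then have "d \<in> (normal_cone S a)\<^sup>\<bottom>"
      using rel_interior_normal_cone_orthogonal[OF g Nd] by simp
    then have "d \<bullet> H d \<ge> \<kappa>" using pos d(1) by force
    moreover have "d \<bullet> H d \<le> \<kappa> / 2"
    proof (rule tendsto_le[OF sequentially_bot tendsto_const lim])
      have "eventually (\<lambda>n. gradient f a \<bullet> u (s n) + t (s n) / 2 * (u (s n) \<bullet> H (u (s n)))
          \<le> \<kappa> / 4 * t (s n)) sequentially"
        using ev[of "\<kappa> / 4"] \<open>\<kappa> > 0\<close> by simp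
      then show "eventually (\<lambda>n. u (s n) \<bullet> H (u (s n)) \<le> \<kappa> / 2) sequentially"
      proof eventually_elim
        case (elim n)
        then have "t (s n) * (u (s n) \<bullet> H (u (s n))) \<le> t (s n) * (\<kappa> / 2)"
          using gu[of "s n"] by (simp add: algebra_simps)
        then show ?case using tpos by (simp add: mult_le_cancel_left)
      qed
    qed
    ultimately show False using \<open>\<kappa> > 0\<close> by simp
  qed
  then show thesis using that by blast
qed

section \<open>Block geometry of the feasible polyhedron\<close>

lemma linear_block: "linear (block Q k)"
  by (rule linearI) (auto simp: block_def vec_eq_iff)

lemma block_diff: "block Q k (x - y) = block Q k x - block Q k y"
  by (rule linear_diff[OF linear_block])

lemma block_idem [simp]: "block Q k (block Q k x) = block Q k x"
  by (auto simp: block_def vec_eq_iff)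

lemma block_eq_self: "u \<in> block_space Q k \<Longrightarrow> block Q k u = u"
  by (auto simp: block_def block_space_def vec_eq_iff)

lemma inner_block: "block Q k x \<bullet> y = x \<bullet> block Q k y"
  by (auto simp: block_def inner_vec_def intro!: sum.cong)

lemma norm_block_le: "norm (block Q k x) \<le> norm x"
  by (auto simp: block_def intro!: norm_le_componentwise_cart)

lemma sum_blocks: "(\<Sum>j\<in>J. block Q j x) = (\<chi> i. if blk Q i \<in> J then x $ i else 0)"
  if "finite J"
  using that by (auto simp: vec_eq_iff block_def)

lemma closed_Omega_block: "closed (\<Omega>_block Q k)"
proof -
  have "\<Omega>_block Q k = {u. \<forall>i. blk Q i \<noteq> k \<longrightarrow> u $ i = 0} \<inter>
      {u. \<forall>i. i \<in> {1..ncons Q k} \<longrightarrow> \<omega> Q k i \<bullet> u \<le> h Q k i}"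
    by (auto simp: \<Omega>_block_def block_space_def)
  also have "closed \<dots>"
    by (intro closed_Int closed_Collect_all closed_Collect_imp open_Collect_const
      closed_Collect_eq closed_Collect_le continuous_intros)
  finally show ?thesis .
qed

lemma convex_Omega_block: "convex (\<Omega>_block Q k)"
proof -
  have "u * a + v * b \<le> c" if "a \<le> c" "b \<le> c" "0 \<le> u" "0 \<le> v" "u + v = 1" for u v a b c :: real
    using that convex_bound_le[of a c b u v] by simp
  then show ?thesis
    by (auto simp: convex_def \<Omega>_block_def block_space_def inner_add_right)
qed

lemma Omega_eq: "\<Omega> Q = (\<Inter>k\<in>{1..K Q}. block Q k -` \<Omega>_block Q k)"
  by (auto simp: \<Omega>_def)

lemma closed_Omega: "closed (\<Omega> Q)"
  unfolding Omega_eq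
  by (intro closed_INT ballI closed_vimage closed_Omega_block)
     (simp add: linear_continuous_on linear_block linear_linear)

lemma convex_Omega: "convex (\<Omega> Q)"
  unfolding Omega_eq
  by (intro convex_INT convex_linear_vimage convex_Omega_block linear_block)

lemma splice_eq: "splice Q k z u x = splice Q k z 0 x + block Q k u"
  by (auto simp: splice_def block_def vec_eq_iff)

lemma splice_block: "splice Q k z (block Q k u) x = splice Q k z u x"
  by (auto simp: splice_def block_def vec_eq_iff)

text \<open>\<open>splice Q k z x x\<close> is the state of the alternating sweep before block
  \<open>k\<close> is treated. This identity hands the state after block \<open>k\<close> on to
  block \<open>Suc k\<close>; the sweep starts at \<open>x\<close> for \<open>k = 1\<close> and ends
  at \<open>z\<close> for \<open>k = Suc (K Q)\<close>.\<close>

lemma splice_Suc: "splice Q (Suc k) z x x = splice Q k z z x"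
  by (auto simp: splice_def vec_eq_iff less_Suc_eq)

lemma splice_first: "well_typed Q \<Longrightarrow> splice Q 1 z x x = x"
proof -
  assume "well_typed Q"
  then have "\<not> blk Q i < 1" for i by (metis well_typed_def atLeastAtMost_iff not_le)
  then show ?thesis unfolding splice_def by (simp only: if_False if_cancel vec_lambda_eta)
qed

lemma splice_last: "well_typed Q \<Longrightarrow> splice Q (Suc (K Q)) z x x = z"
  by (auto simp: splice_def vec_eq_iff well_typed_def less_Suc_eq_le)

lemma splice_diff:
  assumes "well_typed Q"
  shows "splice Q k z x x - x = (\<Sum>j\<in>{1..<k}. block Q j (z - x))"
  using assms by (auto simp: sum_blocks splice_def vec_eq_iff well_typed_def Suc_le_eq)

section \<open>Model decrease and length of the Cauchy step\<close>

text \<open>Symmetry of \<open>B x\<close> makes the gradient of the quadratic term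
  \<open>B x\<close> applied to the displacement, and \<open>block\<close> is self-adjoint, so it
  passes from the argument onto the gradient.\<close>

lemma gradient_model_splice:
  assumes "transpose (B x) = B x"
  shows "gradient (\<lambda>u. model L B x (splice Q k z u x)) (block Q k x) =
      block Q k (gradient L x + B x *v (splice Q k z x x - x))"
proof (rule gradient_eqI)
  define c where "c = splice Q k z 0 x - x"
  have sym: "v \<bullet> (B x *v w) = w \<bullet> (B x *v v)" for v w
    using dot_lmul_matrix[of v "B x" w] assms
    by (metis inner_commute transpose_matrix_vector)
  have eq: "(\<lambda>u. model L B x (splice Q k z u x)) = (\<lambda>u. L x + gradient L x \<bullet> (c + block Q k u)
      + 1/2 * ((c + block Q k u) \<bullet> (B x *v (c + block Q k u))))"
    by (subst splice_eq) (simp add: model_def c_def algebra_simps)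
  have "splice Q k z x x - x = c + block Q k x"
    by (subst splice_eq) (simp add: c_def)
  then have d: "block Q k (gradient L x + B x *v (splice Q k z x x - x)) =
      block Q k (gradient L x + B x *v (c + block Q k (block Q k x)))"
    by simp
  have bl: "bounded_linear (block Q k)"
    by (simp add: linear_block linear_linear)
  note [derivative_intros] = bounded_linear.has_derivative[OF bl]
    bounded_linear.has_derivative[OF matrix_vector_mul_bounded_linear]
  show "GDERIV (\<lambda>u. model L B x (splice Q k z u x)) (block Q k x) :>
      block Q k (gradient L x + B x *v (splice Q k z x x - x))"
    unfolding gderiv_def eq d
    by (auto intro!: derivative_eq_intros
        simp: fun_eq_iff inner_block[symmetric] inner_add_left inner_add_right algebra_simps sym
          inner_commute[of "gradient L x"])
      (metis inner_block inner_commute)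
qed

text \<open>The form in which the block conditions are used: the block gradient is explicit, and
  \<open>\<nu>\<^sub>5 p\<close> bounds the step length, as it does in both alternatives of the
  definition.\<close>

lemma cauchy_point_block:
  assumes "cauchy_point p Q L B x \<Delta> z" "k \<in> {1..K Q}" "transpose (B x) = B x"
  defines "gk \<equiv> block Q k (gradient L x + B x *v (splice Q k z x x - x))"
  obtains \<alpha> where "\<alpha> > 0" "\<alpha> \<le> \<nu>\<^sub>5 p"
    "block Q k z = closest_point (\<Omega>_block Q k) (block Q k x - \<alpha> *\<^sub>R gk)"
    "model L B x (splice Q k z z x) \<le> model L B x (splice Q k z x x)
       + \<nu>\<^sub>0 p * (gk \<bullet> (block Q k z - block Q k x))"
proof -
  let ?m = "\<lambda>u. model L B x (splice Q k z u x)"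
  have g: "gradient ?m (block Q k x) = gk"
    unfolding gk_def by (rule gradient_model_splice) (rule assms(3))
  obtain \<alpha> where "\<alpha> > 0"
    and z: "block Q k z = closest_point (\<Omega>_block Q k) (block Q k x - \<alpha> *\<^sub>R gk)"
    and le: "?m (closest_point (\<Omega>_block Q k) (block Q k x - \<alpha> *\<^sub>R gk)) \<le> ?m (block Q k x)
       + \<nu>\<^sub>0 p * (gk \<bullet> (closest_point (\<Omega>_block Q k) (block Q k x - \<alpha> *\<^sub>R gk) - block Q k x))"
    and "\<alpha> \<le> \<nu>\<^sub>5 p"
    using bspec[OF assms(1)[unfolded cauchy_point_def] assms(2)] unfolding Let_def g by auto
  then show thesis
    using that[of \<alpha>] unfolding z[symmetric] splice_block by blast
qed

text \<open>The variational inequality of the projection shows that no block step ascends along its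
  block gradient; sufficient decrease then keeps the model from rising, block after block.\<close>

lemma model_cauchy_point_le:
  assumes wt: "well_typed Q" and p: "\<nu>\<^sub>0 p \<ge> 0" and x: "x \<in> \<Omega> Q" and B: "transpose (B x) = B x"
    and z: "cauchy_point p Q L B x \<Delta> z"
  shows "model L B x z \<le> model L B x x"
proof -
  have "model L B x (splice Q k z x x) \<le> model L B x x" if "1 \<le> k" "k \<le> Suc (K Q)" for k
    using that
  proof (induction k rule: dec_induct)
    case base
    then show ?case using splice_first[OF wt] by simp
  next
    case (step k)
    then have k: "k \<in> {1..K Q}" by simp
    define gk where "gk = block Q k (gradient L x + B x *v (splice Q k z x x - x))"
    obtain \<alpha> where \<alpha>: "\<alpha> > 0"
        "block Q k z = closest_point (\<Omega>_block Q k) (block Q k x - \<alpha> *\<^sub>R gk)"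
        "model L B x (splice Q k z z x) \<le> model L B x (splice Q k z x x)
           + \<nu>\<^sub>0 p * (gk \<bullet> (block Q k z - block Q k x))"
      using cauchy_point_block[OF z k B] unfolding gk_def by blast
    have "block Q k x \<in> \<Omega>_block Q k" using x k by (auto simp: \<Omega>_def)
    from closest_point_dot[OF convex_Omega_block closed_Omega_block this,
        of "block Q k x - \<alpha> *\<^sub>R gk"]
    have "(norm (block Q k x - block Q k z))\<^sup>2 + \<alpha> * (gk \<bullet> (block Q k z - block Q k x)) \<le> 0"
      unfolding \<alpha>(2)[symmetric] by (simp add: power2_norm_eq_inner algebra_simps inner_commute)
    then have "\<alpha> * (gk \<bullet> (block Q k z - block Q k x)) \<le> 0"
      by (smt (verit) zero_le_power2)
    then have "gk \<bullet> (block Q k z - block Q k x) \<le> 0"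
      using \<alpha>(1) by (simp add: mult_le_0_iff)
    then have "\<nu>\<^sub>0 p * (gk \<bullet> (block Q k z - block Q k x)) \<le> 0"
      using p by (rule mult_nonneg_nonpos[rotated])
    then show ?case
      using \<alpha>(3) step by (simp add: splice_Suc)
  qed
  from this[of "Suc (K Q)"] show ?thesis
    using splice_last[OF wt] by simp
qed

text \<open>\<open>\<Omega> Q\<close> is a product, so a feasible change of a single block stays
  feasible; the normal cone condition thus splits into one variational inequality per block, which
  characterises the projection.\<close>

lemma critical_block_fixed:
  assumes a: "a \<in> \<Omega> Q" and g: "- g \<in> normal_cone (\<Omega> Q) a" and k: "k \<in> {1..K Q}" and "\<alpha> \<ge> 0"
  shows "closest_point (\<Omega>_block Q k) (block Q k a - \<alpha> *\<^sub>R block Q k g) = block Q k a"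
proof (rule closest_point_eqI[OF convex_Omega_block closed_Omega_block])
  show "block Q k a \<in> \<Omega>_block Q k"
    using a k by (auto simp: \<Omega>_def)
  fix u assume u: "u \<in> \<Omega>_block Q k"
  then have us: "u \<in> block_space Q k" by (simp add: \<Omega>_block_def)
  have "block Q j (a + (u - block Q k a)) = (if j = k then u else block Q j a)" for j
    using us by (auto simp: block_def block_space_def vec_eq_iff)
  then have "a + (u - block Q k a) \<in> \<Omega> Q"
    using a u by (auto simp: \<Omega>_def)
  then have "g \<bullet> (u - block Q k a) \<ge> 0"
    using g by (fastforce simp: normal_cone_def)
  moreover have "g \<bullet> (u - block Q k a) = block Q k g \<bullet> (u - block Q k a)"
    using us by (simp add: inner_block block_diff block_eq_self)
  ultimately show "(block Q k a - \<alpha> *\<^sub>R block Q k g - block Q k a) \<bullet> (u - block Q k a) \<le> 0"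
    using \<open>\<alpha> \<ge> 0\<close> by simp
qed

text \<open>Each block step at \<open>x\<close> is compared with the corresponding one at
  \<open>a\<close>, which leaves \<open>a\<close> fixed. Besides the distance and the gradient
  difference, the error contains the drift of the earlier blocks, entering through
  \<open>B x\<close>; it accumulates geometrically, hence the power \<open>K Q\<close>.\<close>

lemma cauchy_point_dist:
  assumes wt: "well_typed Q" and ne: "\<forall>k\<in>{1..K Q}. \<Omega>_block Q k \<noteq> {}"
    and B: "transpose (B x) = B x" "onorm ((*v) (B x)) \<le> Bhat"
    and z: "cauchy_point p Q L B x \<Delta> z"
    and a: "a \<in> \<Omega> Q" "- gradient L a \<in> normal_cone (\<Omega> Q) a"
    and p: "0 \<le> \<nu>\<^sub>5 p"
  shows "norm (z - x) \<le> (3 + \<nu>\<^sub>5 p + \<nu>\<^sub>5 p * Bhat) ^ K Q * (norm (x - a) + norm (gradient L x - gradient L a))"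
proof -
  define S where "S = norm (x - a) + norm (gradient L x - gradient L a)"
  \<comment> \<open>The \<open>2\<close> counts \<open>norm (x - a)\<close> once from the projection
    and once from the triangle inequality; \<open>\<nu>\<^sub>5 p\<close> weighs the gradient
    difference, and \<open>\<nu>\<^sub>5 p * Bhat\<close> the drift \<open>c k\<close> of the blocks
    before \<open>k\<close>.\<close>
  define M where "M = 2 + \<nu>\<^sub>5 p + \<nu>\<^sub>5 p * Bhat"
  define c where "c k = (\<Sum>j\<in>{1..<k}. norm (block Q j (z - x)))" for k
  have Bv: "norm (B x *v v) \<le> Bhat * norm v" for v
    by (rule order_trans[OF onorm[OF matrix_vector_mul_bounded_linear]])
       (rule mult_right_mono[OF B(2)], simp)
  have Bhat: "0 \<le> Bhat"
    using B(2) onorm_pos_le[OF matrix_vector_mul_bounded_linear] by (rule order_trans[rotated])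
  have c0: "0 \<le> c k" for k unfolding c_def by (intro sum_nonneg) simp
  have S0: "0 \<le> S" unfolding S_def by simp
  have wc: "norm (splice Q k z x x - x) \<le> c k" for k
    unfolding splice_diff[OF wt] c_def by (rule norm_sum)
  have step: "norm (block Q k (z - x)) \<le> M * (S + c k)" if k: "k \<in> {1..K Q}" for k
  proof -
    let ?P = "closest_point (\<Omega>_block Q k)"
    let ?g = "gradient L x + B x *v (splice Q k z x x - x)"
    obtain \<alpha> where \<alpha>: "\<alpha> > 0" "\<alpha> \<le> \<nu>\<^sub>5 p" "block Q k z = ?P (block Q k x - \<alpha> *\<^sub>R block Q k ?g)"
      using cauchy_point_block[OF z k B(1)] by blast
    have fix_a: "block Q k a = ?P (block Q k a - \<alpha> *\<^sub>R block Q k (gradient L a))"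
      using critical_block_fixed[OF a k] \<alpha>(1) by simp
    have "norm (block Q k z - block Q k a)
        \<le> norm ((block Q k x - \<alpha> *\<^sub>R block Q k ?g) - (block Q k a - \<alpha> *\<^sub>R block Q k (gradient L a)))"
      unfolding \<alpha>(3) using fix_a closest_point_lipschitz[OF convex_Omega_block closed_Omega_block] ne k
      by (metis dist_norm)
    also have "(block Q k x - \<alpha> *\<^sub>R block Q k ?g) - (block Q k a - \<alpha> *\<^sub>R block Q k (gradient L a))
        = block Q k ((x - a) - \<alpha> *\<^sub>R (?g - gradient L a))"
      by (simp add: block_def vec_eq_iff algebra_simps)
    also have "norm \<dots> \<le> norm (x - a) + \<alpha> * norm (?g - gradient L a)"
      using norm_triangle_ineq4[of "x - a" "\<alpha> *\<^sub>R (?g - gradient L a)"] \<alpha>(1)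
      by (intro order_trans[OF norm_block_le]) simp
    also have "\<dots> \<le> norm (x - a) + \<nu>\<^sub>5 p * (norm (gradient L x - gradient L a) + Bhat * c k)"
    proof -
      have "norm (?g - gradient L a)
          \<le> norm (gradient L x - gradient L a) + norm (B x *v (splice Q k z x x - x))"
        using norm_triangle_ineq[of "gradient L x - gradient L a" "B x *v (splice Q k z x x - x)"]
        by (simp add: add_diff_eq diff_add_eq)
      also have "\<dots> \<le> norm (gradient L x - gradient L a) + Bhat * c k"
        using Bv wc Bhat by (intro add_left_mono) (meson mult_left_mono order_trans)
      finally show ?thesis using \<alpha> p by (intro add_left_mono mult_mono) auto
    qed
    finally have "norm (block Q k z - block Q k a)
        \<le> norm (x - a) + \<nu>\<^sub>5 p * (norm (gradient L x - gradient L a) + Bhat * c k)" .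
    moreover have "norm (block Q k x - block Q k a) \<le> norm (x - a)"
      using norm_block_le[of Q k "x - a"] by (simp add: block_diff)
    moreover have "norm (block Q k (z - x)) \<le> norm (block Q k z - block Q k a)
        + norm (block Q k x - block Q k a)"
      using norm_triangle_ineq4[of "block Q k z - block Q k a" "block Q k x - block Q k a"]
      by (simp add: block_diff)
    ultimately have "norm (block Q k (z - x)) \<le> 2 * norm (x - a)
        + \<nu>\<^sub>5 p * norm (gradient L x - gradient L a) + \<nu>\<^sub>5 p * Bhat * c k"
      by (simp add: algebra_simps)
    also have "\<dots> \<le> M * S + M * c k"
    proof -
      have "2 * norm (x - a) \<le> M * norm (x - a)" "\<nu>\<^sub>5 p * Bhat * c k \<le> M * c k"
        "\<nu>\<^sub>5 p * norm (gradient L x - gradient L a) \<le> M * norm (gradient L x - gradient L a)"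
        using p Bhat c0 by (auto simp: M_def intro!: mult_right_mono)
      then show ?thesis by (simp add: S_def distrib_left)
    qed
    finally show ?thesis by (simp add: distrib_left)
  qed
  \<comment> \<open>A discrete Gronwall argument: each block multiplies \<open>S + c\<close> by at
    most \<open>1 + M\<close>. The index is shifted because \<open>c (Suc k)\<close> covers the
    first \<open>k\<close> blocks.\<close>
  have "S + c (Suc k) \<le> (1 + M) ^ k * S" if "k \<le> K Q" for k
    using that
  proof (induction k)
    case 0
    then show ?case by (simp add: c_def)
  next
    case (Suc k)
    have "S + c (Suc (Suc k)) = S + c (Suc k) + norm (block Q (Suc k) (z - x))"
      by (simp add: c_def)
    also have "\<dots> \<le> (1 + M) * (S + c (Suc k))"
      using step[of "Suc k"] Suc.prems by (simp add: algebra_simps)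
    also have "\<dots> \<le> (1 + M) * ((1 + M) ^ k * S)"
      using Suc p Bhat by (intro mult_left_mono) (auto simp: M_def)
    finally show ?case by simp
  qed
  from this[of "K Q"] have "c (Suc (K Q)) \<le> (1 + M) ^ K Q * S" using S0 by simp
  moreover have "norm (z - x) \<le> c (Suc (K Q))"
    using wc[of "Suc (K Q)"] splice_last[OF wt] by simp
  ultimately show ?thesis by (simp add: M_def S_def add.assoc)
qed

section \<open>Decrease along one iteration, and convergence of the iterates\<close>

text \<open>The monotone refinement controls \<open>norm (y - z)\<close> by the model decrease, and
  acceptance bounds \<open>\<eta>\<^sub>1 p\<close> times the latter by the decrease of
  \<open>L\<close>; a rejected step leaves \<open>x\<close> in place.\<close>

lemma trap_step_decrease:
  assumes adm: "admissible p" and wt: "well_typed Q" and x: "x \<in> \<Omega> Q" and B: "transpose (B x) = B x"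
    and z: "cauchy_point p Q L B x \<Delta> z" and y: "refinement p Q L B x \<Delta> z y"
    and upd: "update p L B x \<Delta> y x' \<Delta>'"
  shows "x' \<in> \<Omega> Q" "L x' \<le> L x"
    "x' = x \<or> \<sigma>_lower p * \<eta>\<^sub>1 p * (norm (x' - z))\<^sup>2 \<le> 2 * (L x - L x')"
proof -
  define m where "m = model L B x"
  define \<rho> where "\<rho> = (L x - L y) / (m x - m y)"
  have pos: "\<eta>\<^sub>1 p > 0" "\<gamma>\<^sub>1 p > 0" "\<nu>\<^sub>0 p > 0" "\<sigma>_lower p > 0"
    using adm by (auto simp: admissible_def)
  have yO: "y \<in> \<Omega> Q" and ym: "m x - m y \<ge> \<gamma>\<^sub>1 p * (m x - m z)"
    using y unfolding refinement_def Let_def m_def by blast+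
  obtain s where s: "\<sigma>_lower p < s" "m y + s / 2 * (norm (y - z))\<^sup>2 \<le> m z"
    using y unfolding refinement_def Let_def m_def by auto
  have zx: "m z \<le> m x"
    unfolding m_def using model_cauchy_point_le[OF wt _ x B z] pos by simp
  then have my: "m x - m y \<ge> 0"
    using ym pos by (smt (verit) mult_nonneg_nonneg)
  have cases: "x' = x \<or> x' = y \<and> \<eta>\<^sub>1 p \<le> \<rho>"
    using upd unfolding update_def Let_def m_def[symmetric] \<rho>_def[symmetric]
    by (metis atLeastAtMost_iff not_le)
  have acc: "\<eta>\<^sub>1 p * (m x - m y) \<le> L x - L y" if "\<eta>\<^sub>1 p \<le> \<rho>"
  proof -
    \<comment> \<open>Were the denominator zero, \<open>\<rho>\<close> would be \<open>0\<close> by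
      the convention for division, which is below \<open>\<eta>\<^sub>1 p\<close>.\<close>
    have "m x - m y \<noteq> 0" using that pos by (auto simp: \<rho>_def)
    then have "m x - m y > 0" using my by simp
    then show ?thesis using that by (simp add: \<rho>_def pos_le_divide_eq)
  qed
  show "x' \<in> \<Omega> Q" using cases x yO by auto
  have "0 \<le> \<eta>\<^sub>1 p * (m x - m y)" using my pos by simp
  then show "L x' \<le> L x" using cases acc by fastforce
  have "x' = x" if "\<not> \<sigma>_lower p * \<eta>\<^sub>1 p * (norm (x' - z))\<^sup>2 \<le> 2 * (L x - L x')"
  proof (rule ccontr)
    assume "x' \<noteq> x"
    then have xy: "x' = y" "\<eta>\<^sub>1 p \<le> \<rho>" using cases by auto
    have "\<sigma>_lower p * (norm (y - z))\<^sup>2 \<le> s * (norm (y - z))\<^sup>2"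
      using s(1) by (intro mult_right_mono) auto
    then have "\<sigma>_lower p * (norm (y - z))\<^sup>2 \<le> 2 * (m x - m y)"
      using s(2) zx by simp
    then have "\<eta>\<^sub>1 p * (\<sigma>_lower p * (norm (y - z))\<^sup>2) \<le> \<eta>\<^sub>1 p * (2 * (m x - m y))"
      using pos by (intro mult_left_mono) auto
    then show False using that xy acc by (simp add: algebra_simps)
  qed
  then show "x' = x \<or> \<sigma>_lower p * \<eta>\<^sub>1 p * (norm (x' - z))\<^sup>2 \<le> 2 * (L x - L x')" by blast
qed

text \<open>Iterates near the strict minimiser cannot cross the sphere of radius \<open>r\<close> because the steps
  are short there, and below a certain level of \<open>f\<close> they cannot stay between radii \<open>\<epsilon>\<close> and \<open>r\<close>.\<close>

lemma convergent_to_strict_local_minimum: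
  fixes f :: "'a::euclidean_space \<Rightarrow> real"
  assumes "closed S" and cont: "continuous_on S f"
    and r: "r > 0" "\<And>x. \<lbrakk>x \<in> S; x \<noteq> a; dist x a \<le> r\<rbrakk> \<Longrightarrow> f a < f x"
    and X: "\<And>l. X l \<in> S" "decseq (\<lambda>l. f (X l))"
    and s: "strict_mono s" "(X \<circ> s) \<longlonglongrightarrow> a"
    and short: "\<exists>\<delta>>0. eventually (\<lambda>l. dist (X l) a < \<delta> \<longrightarrow> dist (X (Suc l)) (X l) < r / 2) sequentially"
  shows "X \<longlonglongrightarrow> a"
proof -
  have aS: "a \<in> S"
    using closed_sequentially[OF \<open>closed S\<close> _ s(2)] X(1) by simp
  have fs: "(\<lambda>n. f (X (s n))) \<longlonglongrightarrow> f a"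
    using cont s(2) aS X(1) unfolding continuous_on_sequentially by (auto simp: o_def)
  \<comment> \<open>The subsequence brings some value below \<open>\<mu>\<close>, and monotonicity
    keeps all later ones there.\<close>
  have lvl: "eventually (\<lambda>l. f (X l) < \<mu>) sequentially" if \<mu>: "f a < \<mu>" for \<mu>
  proof -
    obtain n where "f (X (s n)) < \<mu>"
      using order_tendstoD(2)[OF fs \<mu>] by (meson eventually_sequentially order_refl)
    then show ?thesis
      using decseqD[OF X(2)] by (intro eventually_sequentiallyI[of "s n"]) (meson le_less_trans)
  qed
  obtain \<delta> N where \<delta>: "\<delta> > 0"
    and N: "\<And>l. \<lbrakk>l \<ge> N; dist (X l) a < \<delta>\<rbrakk> \<Longrightarrow> dist (X (Suc l)) (X l) < r / 2"
    using short unfolding eventually_sequentially by blast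
  show ?thesis
  proof (rule metric_LIMSEQ_I)
    fix e :: real assume "e > 0"
    \<comment> \<open>The cap \<open>\<delta>\<close> makes the short-step bound apply inside radius
      \<open>\<epsilon>\<close>, and \<open>r / 2\<close> ensures that one more step stays within
      \<open>r\<close>.\<close>
    define \<epsilon> where "\<epsilon> = min e (min \<delta> (r / 2))"
    have \<epsilon>: "0 < \<epsilon>" "\<epsilon> \<le> e" "\<epsilon> \<le> \<delta>" "\<epsilon> \<le> r / 2"
      using \<open>e > 0\<close> \<delta> r(1) by (auto simp: \<epsilon>_def)
    define C where "C = S \<inter> {x. \<epsilon> \<le> dist x a} \<inter> cball a r"
    have "closed {x. \<epsilon> \<le> dist x a}" by (intro closed_Collect_le continuous_intros)
    then have "compact C"
      unfolding C_def using \<open>closed S\<close> by (intro closed_Int_compact closed_Int compact_cball)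
    have "continuous_on C f" using cont by (rule continuous_on_subset) (auto simp: C_def)
    \<comment> \<open>The minimum of \<open>f\<close> over the compact shell \<open>C\<close>
      exceeds \<open>f a\<close> by strictness; for empty \<open>C\<close> any level above
      \<open>f a\<close> serves.\<close>
    obtain \<mu> where \<mu>: "f a < \<mu>" "\<And>x. x \<in> C \<Longrightarrow> \<mu> \<le> f x"
    proof (cases "C = {}")
      case True
      then show ?thesis using that[of "f a + 1"] by simp
    next
      case False
      then obtain x where x: "x \<in> C" "\<And>y. y \<in> C \<Longrightarrow> f x \<le> f y"
        using continuous_attains_inf[OF \<open>compact C\<close> False \<open>continuous_on C f\<close>] by blast
      have "f a < f x"
        by (rule r(2)) (use x(1) \<epsilon>(1) in \<open>auto simp: C_def dist_commute\<close>)
      then show ?thesis using that x(2) by blast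
    qed
    obtain N' where N': "\<And>l. l \<ge> N' \<Longrightarrow> f (X l) < \<mu>"
      using lvl[OF \<mu>(1)] unfolding eventually_sequentially by blast
    have "eventually (\<lambda>n. dist (X (s n)) a < \<epsilon>) sequentially"
      using tendstoD[OF s(2) \<epsilon>(1)] by (simp add: o_def)
    moreover have "eventually (\<lambda>n. s n \<ge> max N N') sequentially"
      using filterlim_subseq[OF s(1)] unfolding filterlim_at_top by blast
    ultimately have "eventually (\<lambda>n. dist (X (s n)) a < \<epsilon> \<and> s n \<ge> max N N') sequentially"
      by (rule eventually_conj)
    then obtain n where n: "dist (X (s n)) a < \<epsilon>" "s n \<ge> max N N'"
      using eventually_happens'[OF sequentially_bot] by blast
    \<comment> \<open>A step from inside radius \<open>\<epsilon>\<close> lands within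
      \<open>r\<close>, and the level \<open>\<mu>\<close> rules out the shell, so it lands inside
      \<open>\<epsilon>\<close> again.\<close>
    have "dist (X l) a < \<epsilon>" if "l \<ge> s n" for l
      using that
    proof (induction l rule: dec_induct)
      case (step l)
      then have "dist (X (Suc l)) (X l) < r / 2" using N \<epsilon>(3) n(2) by simp
      then have "dist (X (Suc l)) a \<le> r"
        using dist_triangle[of "X (Suc l)" a "X l"] step.IH \<epsilon>(4) by simp
      moreover have "X (Suc l) \<notin> C"
        using \<mu>(2) N'[of "Suc l"] step.hyps n(2) by fastforce
      ultimately show ?case using X(1) by (auto simp: C_def dist_commute)
    qed (rule n(1))
    then show "\<exists>no. \<forall>l\<ge>no. dist (X l) a < e" using \<epsilon>(2) by (meson order_less_le_trans)
  qed
qed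

theorem theorem4p2:
  fixes p :: trap_params
    and Q :: "'n::finite block_polyhedron"
    and L :: "real^'n \<Rightarrow> real"
    and B :: "real^'n \<Rightarrow> real^'n^'n"
    and x0 xs :: "real^'n"
    and X :: "nat \<Rightarrow> real^'n"
    and \<Delta> :: "nat \<Rightarrow> real"
    and Bhat \<kappa> :: real
  assumes "admissible p"
    and "well_typed Q"
    and "\<forall>k\<in>{1..K Q}. \<Omega>_block Q k \<noteq> {}"
    and "\<forall>x\<in>\<Omega> Q. transpose (B x) = B x"
    and "x0 \<in> \<Omega> Q"
    and "trap_sequence p Q L B x0 X \<Delta>"
    and "\<forall>l. \<not> critical_point L (\<Omega> Q) (X l)"
    and "bdd_below (L ` {x \<in> \<Omega> Q. L x \<le> L x0})"
    and "\<exists>U. open U \<and> \<Omega> Q \<subseteq> U \<and> (\<forall>x\<in>U. L differentiable (at x)) \<and> continuous_on U (gradient L)"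
    and "uniformly_continuous_on (\<Omega> Q) (gradient L)"
    and "Bhat > 0"
    and "\<forall>x\<in>\<Omega> Q. onorm ((*v) (B x)) \<le> Bhat"
    and "\<exists>r. strict_mono r \<and> (X \<circ> r) \<longlonglongrightarrow> xs"
    and "nondegenerate L (\<Omega> Q) xs"
    and "gradient L differentiable (at xs)"
    and "\<kappa> > 0"
    and "\<forall>v\<in>(normal_cone (\<Omega> Q) xs)\<^sup>\<bottom>. v \<bullet> (hessian L xs *v v) \<ge> \<kappa> * (norm v)\<^sup>2"
  shows "X \<longlonglongrightarrow> xs \<and> critical_point L (\<Omega> Q) xs \<and> nondegenerate L (\<Omega> Q) xs"
proof -
  obtain U where U: "open U" "\<Omega> Q \<subseteq> U" "\<And>x. x \<in> U \<Longrightarrow> L differentiable (at x)"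
    using assms(9) by blast
  obtain s where s: "strict_mono s" "(X \<circ> s) \<longlonglongrightarrow> xs"
    using assms(13) by blast
  have X0: "X 0 = x0" using assms(6) by (simp add: trap_sequence_def)
  obtain Z Y where ZY: "\<And>l. cauchy_point p Q L B (X l) (\<Delta> l) (Z l)"
      "\<And>l. refinement p Q L B (X l) (\<Delta> l) (Z l) (Y l)"
      "\<And>l. update p L B (X l) (\<Delta> l) (Y l) (X (Suc l)) (\<Delta> (Suc l))"
    using assms(6) unfolding trap_sequence_def by metis
  have XO: "X l \<in> \<Omega> Q" for l
  proof (induction l)
    case (Suc l)
    then show ?case using trap_step_decrease(1)[OF assms(1,2) Suc _ ZY] assms(4) by blast
  qed (simp add: X0 assms(5))
  note step = trap_step_decrease[OF assms(1,2) XO _ ZY]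
  have dec: "decseq (\<lambda>l. L (X l))"
    using step(2) assms(4) XO by (simp add: decseq_Suc_iff)
  obtain c where c: "\<And>x. \<lbrakk>x \<in> \<Omega> Q; L x \<le> L x0\<rbrakk> \<Longrightarrow> c \<le> L x"
    using assms(8) unfolding bdd_below_def by blast
  \<comment> \<open>Keeps the iterates in the initial level set, where \<open>c\<close> bounds
    \<open>L\<close> from below.\<close>
  have "L (X l) \<le> L x0" for l using decseqD[OF dec, of 0 l] X0 by simp
  then obtain L' where L': "(\<lambda>l. L (X l)) \<longlonglongrightarrow> L'"
    using decseq_convergent[OF dec, of c] c XO by metis
  have xsO: "xs \<in> \<Omega> Q"
    using closed_sequentially[OF closed_Omega _ s(2)] XO by simp
  have gN: "- gradient L xs \<in> normal_cone (\<Omega> Q) xs"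
    using assms(14) rel_interior_subset unfolding nondegenerate_def by blast
  have crit: "critical_point L (\<Omega> Q) xs"
    by (rule critical_pointI[OF convex_Omega xsO gN])
  have H: "(gradient L has_derivative (*v) (hessian L xs)) (at xs)"
    using assms(15) unfolding hessian_def by (simp add: jacobian_works)
  obtain r where r: "r > 0" "\<And>x. \<lbrakk>x \<in> \<Omega> Q; x \<noteq> xs; dist x xs \<le> r\<rbrakk> \<Longrightarrow> L xs < L x"
    using nondegenerate_strict_local_minimum[OF U(1) _ U(3) H assms(14,16)] U(2) xsO assms(17) by blast
  have contL: "continuous_on (\<Omega> Q) L"
    using U by (intro continuous_at_imp_continuous_on ballI differentiable_imp_continuous_within) auto
  have "X \<longlonglongrightarrow> xs"
  proof (rule convergent_to_strict_local_minimum[OF closed_Omega contL r XO dec s])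
    \<comment> \<open>Only the shortness of steps near \<open>xs\<close> remains. A step is split at
      the Cauchy point \<open>Z l\<close>, and each piece is kept below
      \<open>r / 4\<close>.\<close>
    define A where "A = (3 + \<nu>\<^sub>5 p + \<nu>\<^sub>5 p * Bhat) ^ K Q"
    have pos: "\<nu>\<^sub>5 p > 0" "\<sigma>_lower p * \<eta>\<^sub>1 p > 0"
      using assms(1) by (auto simp: admissible_def)
    have ZX: "norm (Z l - X l) \<le> A * (norm (X l - xs) + norm (gradient L (X l) - gradient L xs))" for l
      unfolding A_def using cauchy_point_dist[OF assms(2,3) _ _ ZY(1) xsO gN, of l Bhat] assms(4,12) XO pos
      by simp
    have "isCont (gradient L) xs"
      using H by (rule has_derivative_continuous)
    \<comment> \<open>The bound in \<open>ZX\<close> vanishes at \<open>xs\<close>, which yields the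
      radius \<open>\<delta>\<close>.\<close>
    then have "((\<lambda>x. A * (norm (x - xs) + norm (gradient L x - gradient L xs))) \<longlongrightarrow>
        A * (norm (xs - xs) + norm (gradient L xs - gradient L xs))) (nhds xs)"
      by (intro tendsto_intros filterlim_ident) (auto simp: isCont_def tendsto_at_iff_tendsto_nhds)
    then have "eventually (\<lambda>x. A * (norm (x - xs) + norm (gradient L x - gradient L xs)) < r / 4) (nhds xs)"
      by (rule order_tendstoD) (use r(1) in simp)
    then obtain \<delta> where \<delta>: "\<delta> > 0"
        "\<And>x. dist x xs < \<delta> \<Longrightarrow> A * (norm (x - xs) + norm (gradient L x - gradient L xs)) < r / 4"
      unfolding eventually_nhds_metric by blast
    \<comment> \<open>Consecutive values of \<open>L\<close> share the limit \<open>L'\<close>, so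
      the decrease in one iteration tends to \<open>0\<close>.\<close>
    have "(\<lambda>l. 2 * (L (X l) - L (X (Suc l)))) \<longlonglongrightarrow> 2 * (L' - L')"
      by (intro tendsto_intros L' LIMSEQ_Suc)
    then have "eventually (\<lambda>l. 2 * (L (X l) - L (X (Suc l))) < \<sigma>_lower p * \<eta>\<^sub>1 p * (r / 4)\<^sup>2) sequentially"
      by (rule order_tendstoD) (use r(1) pos in simp)
    then have "eventually (\<lambda>l. dist (X l) xs < \<delta> \<longrightarrow> dist (X (Suc l)) (X l) < r / 2) sequentially"
    proof eventually_elim
      case (elim l)
      show ?case
      proof
        assume "dist (X l) xs < \<delta>"
        then have zx: "norm (Z l - X l) < r / 4"
          using ZX[of l] \<delta>(2) by (meson le_less_trans)
        have "norm (X (Suc l) - Z l) < r / 4 \<or> X (Suc l) = X l"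
        proof (rule disjCI)
          assume "X (Suc l) \<noteq> X l"
          then have "\<sigma>_lower p * \<eta>\<^sub>1 p * (norm (X (Suc l) - Z l))\<^sup>2 < \<sigma>_lower p * \<eta>\<^sub>1 p * (r / 4)\<^sup>2"
            using step(3)[of l] assms(4) XO elim by fastforce
          then have "(norm (X (Suc l) - Z l))\<^sup>2 < (r / 4)\<^sup>2"
            using pos(2) mult_less_cancel_left_pos by blast
          then show "norm (X (Suc l) - Z l) < r / 4"
            by (rule power2_less_imp_less) (use r(1) in simp)
        qed
        then show "dist (X (Suc l)) (X l) < r / 2"
          using zx r(1) norm_triangle_ineq[of "X (Suc l) - Z l" "Z l - X l"] by (auto simp: dist_norm)
      qed
    qed
    then show "\<exists>\<delta>>0. eventually (\<lambda>l. dist (X l) xs < \<delta> \<longrightarrow> dist (X (Suc l)) (X l) < r / 2) sequentially"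
      using \<delta>(1) by blast
  qed
  then show ?thesis using crit assms(14) by blast
qed

end
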